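(* Let $1\le k\le n-1$, let $A\subseteq\mathbb{R}$, $T:A\times\mathcal{P}(\mathbb{R})\to\mathcal{P}(\mathbb{R})$, $F\in\mathcal{P}(\mathbb{R})$ and $\boldsymbol{\alpha}=(\alpha_1,\ldots,\alpha_n)\in A^n$. Let $(X_1,\ldots,X_n)$ be a random vector with marginal distribution functions $F_{X_i}=T(\alpha_i,F)$ and with an Archimedean copula with generator $\psi$ and inverse generator $\phi$. Let $F_{n-k:n}^{(\boldsymbol{\alpha})}$ be the distribution function of the $(n-k)$-th order statistic $X_{n-k:n}$. For $x\in\mathbb{R}$ such that $0<T(\alpha_i,F)(x)<1$ for all $i$, define $u_i(x)=T(\alpha_i,F)(x)$ and $t_i(x)=\phi(u_i(x))$, $i=1,\ldots,n$. Then $$F_{n-k:n}^{(\boldsymbol{\alpha})}(x)=\sum_{j=n-k}^{n}(-1)^{j-(n-k)}\binom{j-1}{n-k-1}\sum_{\substack{I\subseteq\{1,\dots,n\}\\ |I|=j}}\psi\left(\sum_{i\in I}t_i(x)\right).$$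
   Context: $\mathcal{P}(\mathbb{R})$ is the set of all cumulative distribution functions on $\mathbb{R}$. $X_{n-k:n}$ denotes the $(n-k)$-th smallest among $X_1,\ldots,X_n$. A function $f$ is $d$-monotone ($d\ge2$) on $(a,b)$ if it is differentiable up to order $d-2$ there, $(-1)^if^{(i)}\ge0$ for $i=0,\ldots,d-2$, and $(-1)^{d-2}f^{(d-2)}$ is nonincreasing and convex on $(a,b)$. Let $\psi:[0,\infty)\to[0,1]$ be continuous, $d$-monotone (for some $d\geq 2$) on $(0,\infty)$, with $\psi(0)=1$ and $\lim_{x\to\infty}\psi(x)=0$; its inverse is $\phi(v)=\psi^{-1}(v)=\sup\{x:\psi(x)>v\}$ (with $\sup\emptyset=0$; $\phi(0)$ may be $+\infty$, and $\psi(\infty)=0$). An $n$-dimensional copula $C_\psi$ is Archimedean with generator $\psi$ if $C_\psi(v_1,\ldots,v_n)=\psi(\phi(v_1)+\cdots+\phi(v_n))$ for all $v_i\in[0,1]$. A random vector $(X_1,\ldots,X_n)$ has copula $C$ if $P(X_1\le x_1,\ldots,X_n\le x_n)=C(F_{X_1}(x_1),\ldots,F_{X_n}(x_n))$ for all $x_1,\dots,x_n\in\mathbb{R}$. *)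

theory Defs
  imports "HOL-Probability.Probability"
begin

definition distribution_functions :: "(real \<Rightarrow> real) set" where
  "distribution_functions = {cdf M | M. real_distribution M}"

definition order_statistic :: "nat \<Rightarrow> nat \<Rightarrow> (nat \<Rightarrow> 'a \<Rightarrow> real) \<Rightarrow> 'a \<Rightarrow> real" where
  "order_statistic n r X \<omega> = sort (map (\<lambda>i. X i \<omega>) [1..<Suc n]) ! (r - 1)"

text \<open>The set \<open>S\<close> is meant to be an open interval, so that \<^const>\<open>deriv\<close> at a point of \<open>S\<close> only
  depends on the values of \<open>f\<close> on \<open>S\<close>.\<close>

definition d_monotone_on :: "nat \<Rightarrow> real set \<Rightarrow> (real \<Rightarrow> real) \<Rightarrow> bool" where
  "d_monotone_on d S f \<longleftrightarrow>
     (\<forall>i < d - 2. \<forall>x\<in>S. (deriv ^^ i) f differentiable (at x)) \<and>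
     (\<forall>i \<le> d - 2. \<forall>x\<in>S. 0 \<le> (-1) ^ i * (deriv ^^ i) f x) \<and>
     antimono_on S (\<lambda>x. (-1) ^ (d - 2) * (deriv ^^ (d - 2)) f x) \<and>
     convex_on S (\<lambda>x. (-1) ^ (d - 2) * (deriv ^^ (d - 2)) f x)"

text \<open>Only the values of \<open>\<psi>\<close> on \<open>[0, \<infinity>)\<close> matter.\<close>

definition archimedean_generator :: "(real \<Rightarrow> real) \<Rightarrow> bool" where
  "archimedean_generator \<psi> \<longleftrightarrow>
     \<psi> \<in> {0..} \<rightarrow> {0..1} \<and> continuous_on {0..} \<psi> \<and>
     (\<exists>d\<ge>2. d_monotone_on d {0<..} \<psi>) \<and> \<psi> 0 = 1 \<and> (\<psi> \<longlongrightarrow> 0) at_top"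

text \<open>The supremum is taken in \<^typ>\<open>ennreal\<close>: it is \<open>0\<close> for the empty set, and the inverse at \<open>0\<close>
  is \<open>\<infinity>\<close> if \<open>\<psi>\<close> is positive everywhere.\<close>

definition generator_inverse :: "(real \<Rightarrow> real) \<Rightarrow> real \<Rightarrow> ennreal" where
  "generator_inverse \<psi> v = (SUP x\<in>{x. 0 \<le> x \<and> v < \<psi> x}. ennreal x)"

text \<open>The extension of \<open>\<psi>\<close> to \<open>[0, \<infinity>]\<close> by \<open>\<psi>(\<infinity>) = 0\<close>.\<close>

definition generator_ext :: "(real \<Rightarrow> real) \<Rightarrow> ennreal \<Rightarrow> real" where
  "generator_ext \<psi> t = (if t = \<infinity> then 0 else \<psi> (enn2real t))"

text \<open>A copula is a function on \<open>[0,1]^n\<close> that is grounded, has uniform margins and is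
  \<open>n\<close>-increasing (every box in \<open>[0,1]^n\<close> has nonnegative \<open>C\<close>-volume). Points of the cube are
  extensional functions on \<open>{1..n}\<close>; values of \<open>C\<close> elsewhere are irrelevant.\<close>

definition copula :: "nat \<Rightarrow> ((nat \<Rightarrow> real) \<Rightarrow> real) \<Rightarrow> bool" where
  "copula n C \<longleftrightarrow>
     (\<forall>v \<in> {1..n} \<rightarrow>\<^sub>E {0..1}. (\<exists>i\<in>{1..n}. v i = 0) \<longrightarrow> C v = 0) \<and>
     (\<forall>j\<in>{1..n}. \<forall>v \<in> {1..n} \<rightarrow>\<^sub>E {0..1}. (\<forall>i\<in>{1..n} - {j}. v i = 1) \<longrightarrow> C v = v j) \<and>
     (\<forall>a \<in> {1..n} \<rightarrow>\<^sub>E {0..1}. \<forall>b \<in> {1..n} \<rightarrow>\<^sub>E {0..1}. (\<forall>i\<in>{1..n}. a i \<le> b i) \<longrightarrow>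
        0 \<le> (\<Sum>S\<in>Pow {1..n}. (-1) ^ card S * C (\<lambda>i\<in>{1..n}. if i \<in> S then a i else b i)))"

definition archimedean_copula ::
  "nat \<Rightarrow> (real \<Rightarrow> real) \<Rightarrow> ((nat \<Rightarrow> real) \<Rightarrow> real) \<Rightarrow> bool" where
  "archimedean_copula n \<psi> C \<longleftrightarrow>
     copula n C \<and> archimedean_generator \<psi> \<and>
     (\<forall>v \<in> {1..n} \<rightarrow>\<^sub>E {0..1}. C v = generator_ext \<psi> (\<Sum>i\<in>{1..n}. generator_inverse \<psi> (v i)))"

definition has_copula ::
  "'a measure \<Rightarrow> nat \<Rightarrow> (nat \<Rightarrow> 'a \<Rightarrow> real) \<Rightarrow> ((nat \<Rightarrow> real) \<Rightarrow> real) \<Rightarrow> bool" where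
  "has_copula M n X C \<longleftrightarrow>
     (\<forall>x :: nat \<Rightarrow> real.
        measure M {\<omega> \<in> space M. \<forall>i\<in>{1..n}. X i \<omega> \<le> x i} =
        C (\<lambda>i\<in>{1..n}. cdf (distr M borel (X i)) (x i)))"

end

theory Submission
  imports Defs
begin

text \<open>If \<open>N\<close> of the variables are at most \<open>x\<close>, then \<open>X\<^bsub>r:n\<^esub> \<le> x\<close> means \<open>r \<le> N\<close>, and the indicator
  of \<open>r \<le> N\<close> is the signed combination of the binomials \<open>N choose j\<close> in \<open>of_bool_le_eq_sum_choose\<close>.
  The expectation of \<open>N choose j\<close> is the sum of the probabilities that \<open>X\<^sub>i \<le> x\<close> for all \<open>i \<in> I\<close>, over
  the sets \<open>I\<close> of size \<open>j\<close>. Such a probability is obtained from the copula by letting the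
  other coordinates tend to infinity; since \<open>\<psi> < 1\<close> on the positive axis, by convexity, the
  inverse generator tends to \<open>0\<close> at \<open>1\<close>, and these coordinates drop out.\<close>

section \<open>Binomial identities\<close>

text \<open>Trinomial revision pulls \<open>N choose (r - 1)\<close> out of the sum and leaves an
  alternating row of Pascal's triangle, which vanishes unless the row has index 0. This sum is the
  increment of the next identity when \<open>N\<close> grows by one.\<close>

lemma sum_alternating_choose_mult:
  assumes "1 \<le> r" "N < n"
  shows "(\<Sum>j=r..n. (-1) ^ (j - r) * real ((j - 1) choose (r - 1)) * real (N choose (j - 1)))
    = of_bool (N = r - 1)"
proof -
  have "(\<Sum>j=r..n. (-1) ^ (j - r) * real ((j - 1) choose (r - 1)) * real (N choose (j - 1)))
    = (\<Sum>j=r..Suc N. (-1) ^ (j - r) * real ((j - 1) choose (r - 1)) * real (N choose (j - 1)))"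
    using assms by (intro sum.mono_neutral_right) auto
  also have "\<dots> = of_bool (N = r - 1)"
  proof (cases "r \<le> Suc N")
    case True
    have "(\<Sum>j=r..Suc N. (-1) ^ (j - r) * real ((j - 1) choose (r - 1)) * real (N choose (j - 1)))
      = (\<Sum>i\<le>Suc N - r. real (N choose (r - 1)) * ((-1) ^ i * real ((Suc N - r) choose i)))"
    proof (rule sum.reindex_bij_witness[of _ "\<lambda>i. i + r" "\<lambda>j. j - r"])
      fix j assume j: "j \<in> {r..Suc N}"
      then have "(N choose (j - 1)) * ((j - 1) choose (r - 1))
        = (N choose (r - 1)) * ((N - (r - 1)) choose (j - 1 - (r - 1)))"
        using assms by (intro choose_mult) auto
      moreover have "N - (r - 1) = Suc N - r" "j - 1 - (r - 1) = j - r"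
        using j assms by auto
      ultimately have "real (N choose (j - 1)) * real ((j - 1) choose (r - 1))
        = real (N choose (r - 1)) * real ((Suc N - r) choose (j - r))"
        by (metis of_nat_mult)
      then show "real (N choose (r - 1)) * ((-1) ^ (j - r) * real ((Suc N - r) choose (j - r)))
        = (-1) ^ (j - r) * real ((j - 1) choose (r - 1)) * real (N choose (j - 1))"
        by (simp add: mult_ac)
    qed (use True in auto)
    also have "\<dots> = real (N choose (r - 1)) * (\<Sum>i\<le>Suc N - r. (-1) ^ i * real ((Suc N - r) choose i))"
      by (simp add: sum_distrib_left)
    also have "\<dots> = of_bool (N = r - 1)"
    proof (cases "Suc N = r")
      case False
      then show ?thesis
        using True assms(1) choose_alternating_sum[of "Suc N - r", where 'a = real] by auto
    qed auto
    finally show ?thesis .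
  qed auto
  finally show ?thesis .
qed

text \<open>Induction on \<open>N\<close>: by Pascal's rule the step adds the previous sum, which is
  1 exactly where the indicator jumps, at \<open>Suc N = r\<close>.\<close>

lemma of_bool_le_eq_sum_choose:
  assumes "1 \<le> r" "N \<le> n"
  shows "of_bool (r \<le> N)
    = (\<Sum>j=r..n. (-1) ^ (j - r) * real ((j - 1) choose (r - 1)) * real (N choose j))"
  using assms(2)
proof (induction N)
  case 0
  have "real (0 choose j) = 0" if "j \<in> {r..n}" for j
    using that assms(1) by (cases j) auto
  then have "(\<Sum>j=r..n. (-1) ^ (j - r) * real ((j - 1) choose (r - 1)) * real (0 choose j)) = 0"
    by (intro sum.neutral) auto
  with assms(1) show ?case by simp
next
  case (Suc N)
  have pascal: "real (Suc N choose j) = real (N choose j) + real (N choose (j - 1))"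
    if "j \<in> {r..n}" for j
    using that assms(1) by (cases j) auto
  have "(\<Sum>j=r..n. (-1) ^ (j - r) * real ((j - 1) choose (r - 1)) * real (Suc N choose j))
    = (\<Sum>j=r..n. (-1) ^ (j - r) * real ((j - 1) choose (r - 1)) * real (N choose j))
    + (\<Sum>j=r..n. (-1) ^ (j - r) * real ((j - 1) choose (r - 1)) * real (N choose (j - 1)))"
    unfolding sum.distrib[symmetric]
    by (intro sum.cong refl) (simp add: pascal algebra_simps del: binomial_Suc_Suc)
  also have "\<dots> = of_bool (r \<le> N) + of_bool (N = r - 1)"
    using Suc sum_alternating_choose_mult[OF assms(1), of N n] by simp
  also have "\<dots> = of_bool (r \<le> Suc N)"
    using assms(1) by (auto simp: of_bool_def)
  finally show ?case by simp
qed

section \<open>Order statistics\<close>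

text \<open>In a sorted list the entries that are at most \<open>x\<close> form an initial
  segment.\<close>

lemma sorted_nth_le_iff_length_filter:
  fixes ys :: "'a :: linorder list"
  assumes "sorted ys" "i < length ys"
  shows "ys ! i \<le> x \<longleftrightarrow> i < length (filter (\<lambda>y. y \<le> x) ys)"
  using assms
proof (induction ys arbitrary: i)
  case (Cons y ys)
  show ?case
  proof (cases "y \<le> x")
    case True
    then show ?thesis using Cons by (cases i) auto
  next
    case False
    then have "\<forall>z\<in>set (y # ys). \<not> z \<le> x"
      using Cons.prems(1) by auto
    moreover from this have "filter (\<lambda>z. z \<le> x) (y # ys) = []"
      by (simp add: filter_empty_conv)
    ultimately show ?thesis
      using nth_mem[OF Cons.prems(2)] by auto
  qed
qed simp

lemma order_statistic_le_iff:
  assumes "1 \<le> r" "r \<le> n"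
  shows "order_statistic n r X \<omega> \<le> x \<longleftrightarrow> r \<le> card {i\<in>{1..n}. X i \<omega> \<le> x}"
proof -
  let ?xs = "map (\<lambda>i. X i \<omega>) [1..<Suc n]"
  have "length (filter (\<lambda>y. y \<le> x) (sort ?xs)) = length (filter (\<lambda>y. y \<le> x) ?xs)"
    by (simp flip: size_mset add: mset_filter)
  also have "\<dots> = length (filter (\<lambda>i. X i \<omega> \<le> x) [1..<Suc n])"
    by (simp add: filter_map o_def del: upt_Suc)
  \<comment> \<open>Counting distinct indices instead of values keeps the multiplicity of
    ties.\<close>
  also have "\<dots> = card (set (filter (\<lambda>i. X i \<omega> \<le> x) [1..<Suc n]))"
    by (rule distinct_card[symmetric]) simp
  also have "set (filter (\<lambda>i. X i \<omega> \<le> x) [1..<Suc n]) = {i\<in>{1..n}. X i \<omega> \<le> x}"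
    by auto
  finally show ?thesis
    using assms sorted_nth_le_iff_length_filter[of "sort ?xs" "r - 1" x]
    by (simp add: order_statistic_def del: upt_Suc) linarith
qed

text \<open>A sublevel set is the event that a finite sum of indicators reaches
  \<open>r\<close>.\<close>

lemma borel_measurable_order_statistic:
  assumes "\<And>i. i \<in> {1..n} \<Longrightarrow> X i \<in> borel_measurable M" "1 \<le> r" "r \<le> n"
  shows "order_statistic n r X \<in> borel_measurable M"
proof (subst borel_measurable_iff_le, intro allI)
  fix x
  have "card {i\<in>{1..n}. X i \<omega> \<le> x} = (\<Sum>i\<in>{1..n}. if X i \<omega> \<le> x then 1 else 0)" for \<omega>
    by (simp add: sum.If_cases Int_def)
  moreover have "(\<lambda>\<omega>. \<Sum>i\<in>{1..n}. if X i \<omega> \<le> x then 1 else 0 :: nat) \<in> measurable M (count_space UNIV)"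
    using assms(1) by measurable
  ultimately show "{\<omega> \<in> space M. order_statistic n r X \<omega> \<le> x} \<in> sets M"
    by (simp add: order_statistic_le_iff[OF assms(2,3)])
qed

text \<open>Inclusion-exclusion for at least \<open>r\<close> of \<open>n\<close> events: the
  pointwise binomial identity is integrated term by term.\<close>

lemma (in prob_space) prob_count_ge_eq_sum:
  fixes P :: "nat \<Rightarrow> 'a \<Rightarrow> bool"
  assumes "\<And>i. i \<in> {1..n} \<Longrightarrow> {\<omega>\<in>space M. P i \<omega>} \<in> events" "1 \<le> r"
  shows "prob {\<omega>\<in>space M. r \<le> card {i\<in>{1..n}. P i \<omega>}} =
    (\<Sum>j=r..n. (-1) ^ (j - r) * real ((j - 1) choose (r - 1)) *
       (\<Sum>I | I \<subseteq> {1..n} \<and> card I = j. prob {\<omega>\<in>space M. \<forall>i\<in>I. P i \<omega>}))"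
proof -
  define E where "E I = {\<omega>\<in>space M. \<forall>i\<in>I. P i \<omega>}" for I
  have fin: "finite {I. I \<subseteq> {1..n} \<and> card I = j}" for j
    by (rule finite_subset[of _ "Pow {1..n}"]) auto
  have E: "E I \<in> events" if "I \<subseteq> {1..n}" for I
    unfolding E_def using assms(1) that finite_subset[OF that]
    by (intro sets.sets_Collect_finite_All) auto
  \<comment> \<open>The binomial counts the \<open>j\<close>-subsets of the indices whose events
    occur at \<open>\<omega>\<close>, and these are the \<open>I\<close> with
    \<open>\<omega> \<in> E I\<close>.\<close>
  have count: "real (card {i\<in>{1..n}. P i \<omega>} choose j)
      = (\<Sum>I | I \<subseteq> {1..n} \<and> card I = j. indicator (E I) \<omega>)"
    if "\<omega> \<in> space M" for \<omega> j
  proof -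
    have "(\<Sum>I | I \<subseteq> {1..n} \<and> card I = j. indicator (E I) \<omega> :: real)
      = real (card ({I. I \<subseteq> {1..n} \<and> card I = j} \<inter> {I. \<omega> \<in> E I}))"
      using fin by (simp add: indicator_def sum.If_cases)
    also have "{I. I \<subseteq> {1..n} \<and> card I = j} \<inter> {I. \<omega> \<in> E I}
      = {I. I \<subseteq> {i\<in>{1..n}. P i \<omega>} \<and> card I = j}"
      using that by (auto simp: E_def)
    finally show ?thesis by (simp add: n_subsets)
  qed
  let ?c = "\<lambda>j. (-1) ^ (j - r) * real ((j - 1) choose (r - 1))"
  let ?B = "{\<omega>\<in>space M. r \<le> card {i\<in>{1..n}. P i \<omega>}}"
  have "prob ?B = (\<integral>\<omega>. indicator ?B \<omega> \<partial>M)"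
    by (simp add: Int_absorb2)
  also have "\<dots> = (\<integral>\<omega>. (\<Sum>j=r..n. ?c j * (\<Sum>I | I \<subseteq> {1..n} \<and> card I = j. indicator (E I) \<omega>)) \<partial>M)"
  proof (rule Bochner_Integration.integral_cong[OF refl])
    fix \<omega> assume \<omega>: "\<omega> \<in> space M"
    have "card {i\<in>{1..n}. P i \<omega>} \<le> card {1..n}"
      by (intro card_mono) auto
    then have "card {i\<in>{1..n}. P i \<omega>} \<le> n" by simp
    note of_bool_le_eq_sum_choose[OF assms(2) this]
    moreover have "indicator ?B \<omega> = (of_bool (r \<le> card {i\<in>{1..n}. P i \<omega>}) :: real)"
      using \<omega> by (simp add: indicator_def)
    ultimately show "indicator ?B \<omega>
      = (\<Sum>j=r..n. ?c j * (\<Sum>I | I \<subseteq> {1..n} \<and> card I = j. indicator (E I) \<omega>))"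
      by (simp only: count[OF \<omega>])
  qed
  also have "\<dots> = (\<Sum>j=r..n. ?c j * (\<Sum>I | I \<subseteq> {1..n} \<and> card I = j. prob (E I)))"
  proof -
    have int: "integrable M (indicator (E I) :: 'a \<Rightarrow> real)" if "I \<subseteq> {1..n}" for I
      using E[OF that] by (simp add: emeasure_eq_measure)
    have "(\<integral>\<omega>. indicator (E I) \<omega> \<partial>M) = prob (E I)" if "I \<subseteq> {1..n}" for I
      using E[OF that] by (simp add: Int_absorb2 sets.sets_into_space)
    then show ?thesis
      using int by (subst Bochner_Integration.integral_sum, force)
        (simp add: Bochner_Integration.integral_sum)
  qed
  finally show ?thesis by (simp add: E_def)
qed

section \<open>Archimedean generators\<close>

text \<open>The available derivatives depend on \<open>d\<close>. For \<open>d = 2\<close> both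
  claims are part of the definition. For larger \<open>d\<close>, antitonicity comes from
  \<open>f' \<le> 0\<close>; convexity comes from monotonicity of \<open>f'\<close> if
  \<open>d = 3\<close> and from \<open>f'' \<ge> 0\<close> if \<open>d \<ge> 4\<close>.\<close>

lemma d_monotone_on_imp_convex_antimono:
  assumes "d_monotone_on d {0<..} f" "2 \<le> d"
  shows "convex_on {0<..} f" and "antimono_on {0<..} f"
proof -
  have "convex_on {0<..} f \<and> antimono_on {0<..} f"
  proof (cases "d = 2")
    case True
    with assms show ?thesis by (simp add: d_monotone_on_def)
  next
    case False
    then have d: "d - 2 > 0" using assms(2) by simp
    have diff: "(deriv ^^ i) f differentiable (at x)" if "i < d - 2" "0 < x" for i x
      using assms(1) that by (simp add: d_monotone_on_def)
    have sign: "0 \<le> (-1) ^ i * (deriv ^^ i) f x" if "i \<le> d - 2" "0 < x" for i x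
      using assms(1) that by (simp add: d_monotone_on_def)
    have f': "(f has_real_derivative deriv f x) (at x)" if "0 < x" for x
      using diff[OF d that] by (simp add: DERIV_deriv_iff_real_differentiable)
    have f'_nonpos: "deriv f x \<le> 0" if "0 < x" for x
      using sign[of 1 x] that d by simp
    have "antimono_on {0<..} f"
    proof (rule monotone_onI)
      fix x y :: real assume "x \<in> {0<..}" "y \<in> {0<..}" "x \<le> y"
      then have "\<exists>D. (f has_real_derivative D) (at z) \<and> D \<le> 0" if "x \<le> z" for z
        using f'[of z] f'_nonpos[of z] that by auto
      with \<open>x \<le> y\<close> show "f y \<le> f x"
        by (intro DERIV_nonpos_imp_nonincreasing[of x y f]) auto
    qed
    moreover have "convex_on {0<..} f"
    proof (cases "d = 3")
      case True
      then have "antimono_on {0<..} (\<lambda>x. - deriv f x)"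
        using assms(1) by (simp add: d_monotone_on_def)
      then show ?thesis
        by (intro convex_on_realI[where f' = "deriv f"] f') (auto simp: monotone_on_def)
    next
      case False
      with \<open>d \<noteq> 2\<close> assms(2) have d: "1 < d - 2" by simp
      have "(deriv f has_real_derivative deriv (deriv f) x) (at x)" if "0 < x" for x
        using diff[OF d that] by (simp add: DERIV_deriv_iff_real_differentiable)
      moreover have "0 \<le> deriv (deriv f) x" if "0 < x" for x
        using sign[of 2 x] that d by (simp add: numeral_2_eq_2)
      ultimately show ?thesis
        by (intro f''_ge0_imp_convex[of _ _ "deriv f" "deriv (deriv f)"] f') auto
    qed
    ultimately show ?thesis by blast
  qed
  then show "convex_on {0<..} f" and "antimono_on {0<..} f" by auto
qed

text \<open>The limit 0 gives some \<open>z > x\<close> with \<open>\<psi> z < 1\<close>, and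
  convexity between \<open>x / 2\<close> and \<open>z\<close> carries strictness back to
  \<open>x\<close>. The left point is \<open>x / 2\<close> because convexity is known only on the
  open half-line.\<close>

lemma archimedean_generator_less_1:
  assumes "archimedean_generator \<psi>" "0 < x"
  shows "\<psi> x < 1"
proof -
  have "convex_on {0<..} \<psi>"
    using assms(1) d_monotone_on_imp_convex_antimono(1) by (auto simp: archimedean_generator_def)
  have "eventually (\<lambda>z. \<psi> z < 1) at_top"
    using assms(1) by (auto simp: archimedean_generator_def intro: order_tendstoD)
  then obtain z where z: "\<psi> z < 1" "x < z"
    using eventually_gt_at_top[of x] eventually_happens[OF eventually_conj] trivial_limit_at_top_linorder
    by blast
  \<comment> \<open>The weight that makes \<open>x\<close> the convex combination of
    \<open>x / 2\<close> and \<open>z\<close>.\<close>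
  define t where "t = (x / 2) / (z - x / 2)"
  have t: "0 < t" "t < 1"
    using assms(2) z by (auto simp: t_def)
  have "z - x / 2 \<noteq> 0"
    using assms(2) z by simp
  then have "t * (z - x / 2) = x / 2"
    unfolding t_def by (metis nonzero_divide_eq_eq)
  then have "(1 - t) * (x / 2) + t * z = x"
    by (simp add: field_simps)
  then have "\<psi> x \<le> (1 - t) * \<psi> (x / 2) + t * \<psi> z"
    using convex_onD[OF \<open>convex_on {0<..} \<psi>\<close>, of t "x / 2" z] t z assms(2) by simp
  also have "\<dots> < (1 - t) * 1 + t * 1"
    using t z assms by (intro add_le_less_mono mult_left_mono mult_strict_left_mono)
      (auto simp: archimedean_generator_def)
  finally show ?thesis by simp
qed

text \<open>Since \<open>\<psi>\<close> eventually drops below \<open>v\<close>, the supremum runs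
  over a bounded set.\<close>

lemma generator_inverse_finite:
  assumes "archimedean_generator \<psi>" "0 < v"
  shows "generator_inverse \<psi> v < \<infinity>"
proof -
  have "eventually (\<lambda>z. \<psi> z < v) at_top"
    using assms by (auto simp: archimedean_generator_def intro: order_tendstoD)
  then obtain b where b: "\<And>z. b \<le> z \<Longrightarrow> \<psi> z < v"
    by (auto simp: eventually_at_top_linorder)
  have "generator_inverse \<psi> v \<le> ennreal b"
    unfolding generator_inverse_def
  proof (rule SUP_least)
    fix x assume "x \<in> {x. 0 \<le> x \<and> v < \<psi> x}"
    then show "ennreal x \<le> ennreal b"
      using b[of x] by (intro ennreal_leI) force
  qed
  then show ?thesis by (simp add: order_le_less_trans)
qed

text \<open>For \<open>e > 0\<close>, \<open>\<psi> e < 1\<close> is eventually below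
  \<open>v m\<close>; as \<open>\<psi>\<close> is antitone, every point where it exceeds
  \<open>v m\<close> is then at most \<open>e\<close>.\<close>

lemma generator_inverse_tendsto_0:
  assumes "archimedean_generator \<psi>" "(v \<longlongrightarrow> 1) F"
  shows "((\<lambda>m. generator_inverse \<psi> (v m)) \<longlongrightarrow> 0) F"
proof (rule order_tendstoI)
  fix a :: ennreal assume "0 < a"
  \<comment> \<open>An intermediate value is finite even if \<open>a\<close> is not, and it restores
    strictness after a supremum bound that is only \<open>\<le>\<close>.\<close>
  then obtain b where b: "0 < b" "b < a"
    using dense by blast
  then obtain e where "b = ennreal e" "0 \<le> e"
    by (cases b) auto
  with b have e: "0 < e" "ennreal e < a"
    by auto
  have anti: "antimono_on {0<..} \<psi>"
    using assms(1) d_monotone_on_imp_convex_antimono(2) by (auto simp: archimedean_generator_def)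
  have "eventually (\<lambda>m. \<psi> e < v m) F"
    using archimedean_generator_less_1[OF assms(1) e(1)] assms(2) by (auto intro: order_tendstoD)
  then show "eventually (\<lambda>m. generator_inverse \<psi> (v m) < a) F"
  proof eventually_elim
    case (elim m)
    have "generator_inverse \<psi> (v m) \<le> ennreal e"
      unfolding generator_inverse_def
    proof (rule SUP_least)
      fix x assume x: "x \<in> {x. 0 \<le> x \<and> v m < \<psi> x}"
      have "x \<le> e"
      proof (rule ccontr)
        assume "\<not> x \<le> e"
        then have "\<psi> x \<le> \<psi> e"
          using e(1) by (intro monotone_onD[OF anti]) auto
        with x elim show False by simp
      qed
      then show "ennreal x \<le> ennreal e" by (rule ennreal_leI)
    qed
    with e(2) show ?case by (rule le_less_trans[rotated])
  qed
qed simp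

lemma tendsto_generator_ext:
  assumes "archimedean_generator \<psi>" "(s \<longlongrightarrow> l) F" "l < \<infinity>"
  shows "((\<lambda>m. generator_ext \<psi> (s m)) \<longlongrightarrow> generator_ext \<psi> l) F"
proof -
  have "((\<lambda>m. enn2real (s m)) \<longlongrightarrow> enn2real l) F"
    using assms(2,3) by (intro tendsto_enn2real) (auto simp: ennreal_enn2real)
  moreover have "continuous_on {0..} \<psi>"
    using assms(1) by (simp add: archimedean_generator_def)
  ultimately have "((\<lambda>m. \<psi> (enn2real (s m))) \<longlongrightarrow> \<psi> (enn2real l)) F"
    by (elim continuous_on_tendsto_compose) auto
  \<comment> \<open>At infinity \<open>generator_ext\<close> is 0, whereas \<open>enn2real\<close>
    defaults to 0 and would give \<open>\<psi> 0 = 1\<close>. The two expressions agree at finite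
    arguments.\<close>
  moreover have "eventually (\<lambda>m. s m < \<infinity>) F"
    using assms(2,3) by (rule order_tendstoD)
  then have "eventually (\<lambda>m. \<psi> (enn2real (s m)) = generator_ext \<psi> (s m)) F"
    by eventually_elim (auto simp: generator_ext_def)
  ultimately show ?thesis
    using assms(3) by (auto simp: generator_ext_def intro: Lim_transform_eventually)
qed

section \<open>Lower orthant probabilities\<close>

lemma cdf_distr_eq:
  assumes "Y \<in> borel_measurable M"
  shows "cdf (distr M borel Y) x = measure M {\<omega>\<in>space M. Y \<omega> \<le> x}"
  using assms by (simp add: cdf_def measure_distr vimage_def Int_def conj_commute)

text \<open>The limit of full orthant probabilities is computed twice: by continuity from below, and
  through the copula formula. Positivity of the margins in \<open>I\<close> keeps the limiting sum
  finite, where \<open>generator_ext\<close> is continuous.\<close>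

lemma (in prob_space) prob_sub_orthant_archimedean:
  assumes X: "\<And>i. i \<in> {1..n} \<Longrightarrow> X i \<in> borel_measurable M"
    and arch: "archimedean_copula n \<psi> C" and cop: "has_copula M n X C"
    and I: "I \<subseteq> {1..n}" and pos: "\<And>i. i \<in> I \<Longrightarrow> 0 < cdf (distr M borel (X i)) x"
  shows "prob {\<omega>\<in>space M. \<forall>i\<in>I. X i \<omega> \<le> x} =
    generator_ext \<psi> (\<Sum>i\<in>I. generator_inverse \<psi> (cdf (distr M borel (X i)) x))"
proof -
  define G where "G i = cdf (distr M borel (X i))" for i
  \<comment> \<open>Copula thresholds are real, so a missing constraint is approximated by growing
    ones; these make the events increase with \<open>m\<close>.\<close>
  define y where "y m i = (if i \<in> I then x else x + real m)" for m i
  define E where "E m = {\<omega>\<in>space M. \<forall>i\<in>{1..n}. X i \<omega> \<le> y m i}" for m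
  have gen: "archimedean_generator \<psi>"
    using arch by (simp add: archimedean_copula_def)
  have distr: "real_distribution (distr M borel (X i))" if "i \<in> {1..n}" for i
    using X[OF that] by (simp add: real_distribution_distr)
  have G01: "G i z \<in> {0..1}" if "i \<in> {1..n}" for i z
    using distr[OF that]
    by (simp add: G_def real_distribution.cdf_bounded_prob finite_borel_measure.cdf_nonneg
        real_distribution.finite_borel_measure_M)
  have "(\<lambda>m. prob (E m)) \<longlonglongrightarrow> prob (\<Union>m. E m)"
  proof (rule finite_Lim_measure_incseq)
    have "{\<omega>\<in>space M. X i \<omega> \<le> z} \<in> events" if "i \<in> {1..n}" for i z
      using X[OF that] by measurable
    then show "range E \<subseteq> events"
      unfolding E_def by (auto intro!: sets.sets_Collect_finite_All)
    show "incseq E"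
      unfolding E_def y_def by (rule incseq_SucI) (auto intro: order_trans split: if_splits)
  qed
  also have "(\<Union>m. E m) = {\<omega>\<in>space M. \<forall>i\<in>I. X i \<omega> \<le> x}"
  proof (intro equalityI subsetI)
    fix \<omega> assume \<omega>: "\<omega> \<in> {\<omega>\<in>space M. \<forall>i\<in>I. X i \<omega> \<le> x}"
    \<comment> \<open>One \<open>m\<close> serves all coordinates because there are finitely
      many.\<close>
    obtain m where m: "Max ((\<lambda>i. X i \<omega> - x) ` {1..n}) \<le> real m"
      using real_arch_simple by blast
    have "X i \<omega> \<le> x + real m" if "i \<in> {1..n}" for i
    proof -
      have "X i \<omega> - x \<le> Max ((\<lambda>i. X i \<omega> - x) ` {1..n})"
        using that by (intro Max_ge) auto
      with m show ?thesis by linarith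
    qed
    with \<omega> have "\<omega> \<in> E m" by (auto simp: E_def y_def)
    then show "\<omega> \<in> (\<Union>m. E m)" by blast
  qed (use I in \<open>fastforce simp: E_def y_def\<close>)
  finally have lim1: "(\<lambda>m. prob (E m)) \<longlonglongrightarrow> prob {\<omega>\<in>space M. \<forall>i\<in>I. X i \<omega> \<le> x}" .
  have probE: "prob (E m) = generator_ext \<psi> (\<Sum>i\<in>{1..n}. generator_inverse \<psi> (G i (y m i)))" for m
  proof -
    let ?v = "\<lambda>i\<in>{1..n}. G i (y m i)"
    have "?v \<in> {1..n} \<rightarrow>\<^sub>E {0..1}" using G01 by auto
    moreover have "prob (E m) = C ?v"
      using cop by (simp add: has_copula_def E_def G_def)
    ultimately show ?thesis
      using arch by (simp add: archimedean_copula_def)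
  qed
  have "(\<lambda>m. generator_inverse \<psi> (G i (y m i)))
      \<longlonglongrightarrow> (if i \<in> I then generator_inverse \<psi> (G i x) else 0)"
    if i: "i \<in> {1..n}" for i
  proof (cases "i \<in> I")
    case False
    \<comment> \<open>Outside \<open>I\<close> the margin tends to 1, so the summand tends to
      0.\<close>
    have "filterlim (\<lambda>m. x + real m) at_top sequentially"
      by (intro filterlim_tendsto_add_at_top[OF tendsto_const] filterlim_real_sequentially)
    then have "(\<lambda>m. G i (x + real m)) \<longlonglongrightarrow> 1"
      unfolding G_def by (rule filterlim_compose[OF real_distribution.cdf_lim_at_top_prob[OF distr[OF i]]])
    from generator_inverse_tendsto_0[OF gen this] False show ?thesis by (simp add: y_def)
  qed (simp add: y_def)
  then have "(\<lambda>m. \<Sum>i\<in>{1..n}. generator_inverse \<psi> (G i (y m i)))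
      \<longlonglongrightarrow> (\<Sum>i\<in>{1..n}. if i \<in> I then generator_inverse \<psi> (G i x) else 0)"
    by (rule tendsto_sum)
  also have "(\<Sum>i\<in>{1..n}. if i \<in> I then generator_inverse \<psi> (G i x) else 0)
      = (\<Sum>i\<in>I. generator_inverse \<psi> (G i x))"
    using I by (simp add: sum.If_cases Int_absorb1)
  finally have "(\<lambda>m. prob (E m)) \<longlonglongrightarrow> generator_ext \<psi> (\<Sum>i\<in>I. generator_inverse \<psi> (G i x))"
    unfolding probE using generator_inverse_finite[OF gen pos] finite_subset[OF I]
    by (intro tendsto_generator_ext[OF gen]) (auto simp: G_def)
  from LIMSEQ_unique[OF lim1 this] show ?thesis by (simp add: G_def)
qed

theorem proposition3p12:
  fixes n k :: nat
    and A :: "real set"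
    and T :: "real \<Rightarrow> (real \<Rightarrow> real) \<Rightarrow> (real \<Rightarrow> real)"
    and F :: "real \<Rightarrow> real"
    and \<alpha> :: "nat \<Rightarrow> real"
    and M :: "'a measure"
    and X :: "nat \<Rightarrow> 'a \<Rightarrow> real"
    and C :: "(nat \<Rightarrow> real) \<Rightarrow> real"
    and \<psi> :: "real \<Rightarrow> real"
    and x :: real
  assumes "1 \<le> k" and "k \<le> n - 1"
    and "\<And>a G. a \<in> A \<Longrightarrow> G \<in> distribution_functions \<Longrightarrow> T a G \<in> distribution_functions"
    and "F \<in> distribution_functions"
    and "\<And>i. i \<in> {1..n} \<Longrightarrow> \<alpha> i \<in> A"
    and "prob_space M"
    and "\<And>i. i \<in> {1..n} \<Longrightarrow> X i \<in> borel_measurable M"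
    and "\<And>i. i \<in> {1..n} \<Longrightarrow> cdf (distr M borel (X i)) = T (\<alpha> i) F"
    and "archimedean_copula n \<psi> C"
    and "has_copula M n X C"
    and "\<And>i. i \<in> {1..n} \<Longrightarrow> 0 < T (\<alpha> i) F x \<and> T (\<alpha> i) F x < 1"
  shows "let u = (\<lambda>i. T (\<alpha> i) F x);
             t = (\<lambda>i. generator_inverse \<psi> (u i))
         in cdf (distr M borel (order_statistic n (n - k) X)) x =
            (\<Sum>j = n - k..n. (-1) ^ (j - (n - k)) * real ((j - 1) choose (n - k - 1)) *
               (\<Sum>I | I \<subseteq> {1..n} \<and> card I = j. generator_ext \<psi> (\<Sum>i\<in>I. t i)))"
proof -
  interpret prob_space M by fact
  let ?r = "n - k"
  have r: "1 \<le> ?r" "?r \<le> n" using assms(1,2) by auto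
  have events: "{\<omega>\<in>space M. X i \<omega> \<le> x} \<in> events" if "i \<in> {1..n}" for i
    using assms(7)[OF that] by measurable
  \<comment> \<open>Measurability of the order statistic turns its distribution function into the
    probability that at least \<open>n - k\<close> variables are at most \<open>x\<close>.\<close>
  have "cdf (distr M borel (order_statistic n ?r X)) x
      = prob {\<omega>\<in>space M. ?r \<le> card {i\<in>{1..n}. X i \<omega> \<le> x}}"
    using borel_measurable_order_statistic[OF assms(7) r]
    by (simp add: cdf_distr_eq order_statistic_le_iff[OF r])
  also have "\<dots> = (\<Sum>j=?r..n. (-1) ^ (j - ?r) * real ((j - 1) choose (?r - 1)) *
       (\<Sum>I | I \<subseteq> {1..n} \<and> card I = j. prob {\<omega>\<in>space M. \<forall>i\<in>I. X i \<omega> \<le> x}))"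
    by (rule prob_count_ge_eq_sum[OF events r(1)])
  also have "\<dots> = (\<Sum>j=?r..n. (-1) ^ (j - ?r) * real ((j - 1) choose (?r - 1)) *
       (\<Sum>I | I \<subseteq> {1..n} \<and> card I = j.
          generator_ext \<psi> (\<Sum>i\<in>I. generator_inverse \<psi> (T (\<alpha> i) F x))))"
  \<comment> \<open>The coefficients match, so only the probability attached to each
    \<open>I\<close> remains; its margins at \<open>x\<close> are positive.\<close>
  proof (intro sum.cong refl arg_cong2[where f = "(*)"])
    fix j I assume "I \<in> {I. I \<subseteq> {1..n} \<and> card I = j}"
    then have I: "I \<subseteq> {1..n}" by simp
    then have T: "cdf (distr M borel (X i)) = T (\<alpha> i) F" "0 < T (\<alpha> i) F x" if "i \<in> I" for i
      using assms(8,11) that by blast+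
    then show "prob {\<omega>\<in>space M. \<forall>i\<in>I. X i \<omega> \<le> x}
        = generator_ext \<psi> (\<Sum>i\<in>I. generator_inverse \<psi> (T (\<alpha> i) F x))"
      using prob_sub_orthant_archimedean[OF assms(7,9,10) I, of x] by simp
  qed
  finally show ?thesis by (simp add: Let_def)
qed

end
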